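(* Let $X_1,\dots,X_n$ be Polish spaces, $X=X_1\times\dots\times X_n$, $\mu=(\mu_1,\dots,\mu_n)$ with $\mu_i$ a Borel probability measure on $X_i$, let $W\subset C_L(\mu)$ be a linear subspace and let $c\in C_L(\mu)$. Then the problem $$\inf_{\pi\in\Pi_W(\mu)}\int_X c\,d\pi$$ has a solution (i.e. there is $\pi_*\in\Pi_W(\mu)$ with $\int_X c\,d\pi_*=\inf_{\pi\in\Pi_W(\mu)}\int_X c\,d\pi$) if and only if $\Pi_W(\mu)$ is not empty.
   Context: $\Pi(\mu)$ is the set of Borel probability measures on $X$ whose marginals are $\mu_1,\dots,\mu_n$, i.e. $(\operatorname{Pr}_i)_\#\pi=\mu_i$ for all $i$, where $\operatorname{Pr}_i:X\to X_i$ is the natural projection. $C_L(\mu_i)=L^1(X_i,\mu_i)\cap C(X_i)$ is the space of continuous real-valued $\mu_i$-integrable functions on $X_i$. $C_L(\mu)$ is the space of all continuous $h:X\to\mathbb{R}$ for which there exist $f_i\in C_L(\mu_i)$ ($i=1,\dots,n$) with $|h(x)|\le\sum_{i=1}^n f_i(x_i)$ for all $x=(x_1,\dots,x_n)\in X$. (Every $h\in C_L(\mu)$ is integrable with respect to every $\pi\in\Pi(\mu)$.) For a linear subspace $W\subset C_L(\mu)$, $\Pi_W(\mu)=\{\pi\in\Pi(\mu):\int_X w\,d\pi=0\ \text{for all } w\in W\}$. *)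

theory Defs
  imports "HOL-Probability.Probability"
begin

(* Spaces are abstract topologies rather than types of class polish_space, so that the
   factors X 1, ..., X n may be different Polish spaces: topspace (X i) is an arbitrary subset
   of the type 'a, and any finite family of spaces can be realised inside one common type. *)
definition polish_topology :: "'a topology \<Rightarrow> bool" where
  "polish_topology T \<longleftrightarrow> completely_metrizable_space T \<and> separable_space T"

definition borel_of :: "'a topology \<Rightarrow> 'a measure" where
  "borel_of T = sigma (topspace T) {U. openin T U}"

lemma space_borel_of [simp]: "space (borel_of T) = topspace T"
  unfolding borel_of_def by (rule space_measure_of) (auto dest: openin_subset)

lemma sets_borel_of: "sets (borel_of T) = sigma_sets (topspace T) {U. openin T U}"
  unfolding borel_of_def by (rule sets_measure_of) (auto dest: openin_subset)

definition borel_prob_on :: "'a topology \<Rightarrow> 'a measure \<Rightarrow> bool" where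
  "borel_prob_on T M \<longleftrightarrow> prob_space M \<and> sets M = sets (borel_of T)"

abbreviation prod_top :: "nat \<Rightarrow> (nat \<Rightarrow> 'a topology) \<Rightarrow> (nat \<Rightarrow> 'a) topology" where
  "prod_top n X \<equiv> product_topology X {1..n}"

definition couplings ::
    "nat \<Rightarrow> (nat \<Rightarrow> 'a topology) \<Rightarrow> (nat \<Rightarrow> 'a measure) \<Rightarrow> (nat \<Rightarrow> 'a) measure set" where
  "couplings n X \<mu> =
    {\<pi>. borel_prob_on (prod_top n X) \<pi> \<and>
         (\<forall>i\<in>{1..n}. distr \<pi> (borel_of (X i)) (\<lambda>x. x i) = \<mu> i)}"

(* Functions on a space are represented by HOL functions on the whole ambient type; continuity,
   bounds and integrals only see their values on the topspace. *)
definition CL1 :: "'a topology \<Rightarrow> 'a measure \<Rightarrow> ('a \<Rightarrow> real) set" where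
  "CL1 T M = {f. continuous_map T euclideanreal f \<and> integrable M f}"

definition CL ::
    "nat \<Rightarrow> (nat \<Rightarrow> 'a topology) \<Rightarrow> (nat \<Rightarrow> 'a measure) \<Rightarrow> ((nat \<Rightarrow> 'a) \<Rightarrow> real) set" where
  "CL n X \<mu> =
    {h. continuous_map (prod_top n X) euclideanreal h \<and>
        (\<exists>f. (\<forall>i\<in>{1..n}. f i \<in> CL1 (X i) (\<mu> i)) \<and>
             (\<forall>x\<in>topspace (prod_top n X). \<bar>h x\<bar> \<le> (\<Sum>i=1..n. f i (x i))))}"

(* A subspace of the space of functions on X corresponds to the set of all extensions of its
   members to the ambient type, so exact (rather than up to equality on X) closure conditions
   lose no subspace. *)
definition linear_subspace_fun :: "('b \<Rightarrow> real) set \<Rightarrow> bool" where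
  "linear_subspace_fun W \<longleftrightarrow>
    (\<lambda>x. 0) \<in> W \<and>
    (\<forall>f\<in>W. \<forall>g\<in>W. (\<lambda>x. f x + g x) \<in> W) \<and>
    (\<forall>a. \<forall>f\<in>W. (\<lambda>x. a * f x) \<in> W)"

definition couplings_W ::
    "nat \<Rightarrow> (nat \<Rightarrow> 'a topology) \<Rightarrow> (nat \<Rightarrow> 'a measure) \<Rightarrow> ((nat \<Rightarrow> 'a) \<Rightarrow> real) set
      \<Rightarrow> (nat \<Rightarrow> 'a) measure set" where
  "couplings_W n X \<mu> W = {\<pi> \<in> couplings n X \<mu>. \<forall>w\<in>W. (\<integral>x. w x \<partial>\<pi>) = 0}"

lemma continuous_map_measurable_borel_of:
  assumes "continuous_map S T f"
  shows "f \<in> borel_of S \<rightarrow>\<^sub>M borel_of T"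
proof -
  have "f \<in> borel_of S \<rightarrow>\<^sub>M sigma (topspace T) {U. openin T U}"
  proof (rule measurable_measure_of)
    show "{U. openin T U} \<subseteq> Pow (topspace T)" by (auto dest: openin_subset)
    show "f \<in> space (borel_of S) \<rightarrow> topspace T"
      using assms by (simp add: continuous_map_def)
    fix U assume "U \<in> {U. openin T U}"
    then have "openin S {x \<in> topspace S. f x \<in> U}"
      using assms by (simp add: continuous_map_def)
    moreover have "f -` U \<inter> space (borel_of S) = {x \<in> topspace S. f x \<in> U}" by auto
    ultimately show "f -` U \<inter> space (borel_of S) \<in> sets (borel_of S)"
      by (auto simp: sets_borel_of intro: sigma_sets.Basic)
  qed
  then show ?thesis by (simp add: borel_of_def)
qed

lemma borel_of_euclidean: "borel_of euclidean = borel"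
  unfolding borel_of_def borel_def by simp

(* The Bochner integrals of members of CL are genuine, not the default value 0. *)
lemma CL_integrable:
  assumes h: "h \<in> CL n X \<mu>" and p: "\<pi> \<in> couplings n X \<mu>"
  shows "integrable \<pi> h"
proof -
  have sp: "sets \<pi> = sets (borel_of (prod_top n X))"
    and marg: "\<And>i. i \<in> {1..n} \<Longrightarrow> distr \<pi> (borel_of (X i)) (\<lambda>x. x i) = \<mu> i"
    using p by (auto simp: couplings_def borel_prob_on_def)
  have space: "space \<pi> = topspace (prod_top n X)"
    using sets_eq_imp_space_eq[OF sp] by (simp only: space_borel_of)
  have hc: "continuous_map (prod_top n X) euclideanreal h"
    using h by (simp add: CL_def)
  obtain f where f: "\<And>i. i \<in> {1..n} \<Longrightarrow> f i \<in> CL1 (X i) (\<mu> i)"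
    and bd: "\<And>x. x \<in> topspace (prod_top n X) \<Longrightarrow> \<bar>h x\<bar> \<le> (\<Sum>i=1..n. f i (x i))"
    using h unfolding CL_def by blast
  have hm: "h \<in> borel_measurable \<pi>"
    using continuous_map_measurable_borel_of[OF hc]
    unfolding borel_of_euclidean measurable_cong_sets[OF sp refl] .
  have fi: "integrable \<pi> (\<lambda>x. f i (x i))" if i: "i \<in> {1..n}" for i
  proof -
    have m: "(\<lambda>x. x i) \<in> \<pi> \<rightarrow>\<^sub>M borel_of (X i)"
      using continuous_map_measurable_borel_of[OF continuous_map_product_projection[OF i, of X]]
      unfolding measurable_cong_sets[OF sp refl] .
    have "integrable (distr \<pi> (borel_of (X i)) (\<lambda>x. x i)) (f i)"
      using f[OF i] marg[OF i] by (simp add: CL1_def)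
    then show ?thesis by (rule integrable_distr[OF m])
  qed
  have "integrable \<pi> (\<lambda>x. \<Sum>i=1..n. f i (x i))"
    by (rule Bochner_Integration.integrable_sum) (rule fi)
  then show ?thesis
  proof (rule Bochner_Integration.integrable_bound[OF _ hm])
    show "AE x in \<pi>. norm (h x) \<le> norm (\<Sum>i=1..n. f i (x i))"
      by (rule AE_I2) (use bd space in force)
  qed
qed

end

theory Submission
  imports Defs
begin

text \<open>
  Compactness of the set of couplings is obtained without weak convergence. Along a filter of
  couplings, Tychonoff's theorem yields a finer filter along which the mass of every set converges,
  to a finitely additive set function. The couplings share their marginals, so by their tightness
  boxes of open or closed sets, and complements of such boxes, can be approximated from inside by
  compact sets uniformly in the coupling. On the algebra of all sets with this property the limit is
  therefore countably additive, and Caratheodory's theorem extends it to a coupling. A function in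
  \<open>C\<^sub>L(\<mu>)\<close> is close in integral, uniformly in the coupling, to a step function over
  this algebra, so integrals converge too. Applied to the filter of sublevel sets of the
  cost within \<open>\<Pi>\<^sub>W(\<mu>)\<close>, this gives a minimizer.
\<close>

section \<open>Inner regularity on Polish topologies\<close>

text \<open>Balls of radius \<open>1 / real (Suc k)\<close> around the points of a countable dense
  set form a base. Second countability later allows open sets of the product to be written as
  countable unions of boxes.\<close>

lemma separable_metrizable_imp_second_countable:
  assumes "metrizable_space T" "separable_space T"
  shows "second_countable T"
proof -
  obtain M d where "Metric_space M d" and T: "T = Metric_space.mtopology M d"
    using assms(1) by (auto simp: metrizable_space_def)
  interpret Metric_space M d by fact
  obtain C where C: "countable C" "C \<subseteq> M" "mtopology closure_of C = M"
    using assms(2) by (auto simp: T separable_space_def)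
  define B where "B = (\<lambda>(c, k). mball c (1 / real (Suc k))) ` (C \<times> (UNIV :: nat set))"
  show ?thesis
    unfolding second_countable_def
  proof (intro exI[of _ B] conjI allI impI ballI)
    show "countable B"
      unfolding B_def using C(1) by (intro countable_image) auto
    show "openin T V" if "V \<in> B" for V
      using that by (auto simp: B_def T)
    fix U x assume Ux: "openin T U \<and> x \<in> U"
    then obtain r where r: "r > 0" "mball x r \<subseteq> U" and x: "x \<in> M"
      unfolding T openin_mtopology by blast
    \<comment> \<open>With \<open>r / 2\<close> the triangle inequality leaves room: a centre closer
      than \<open>1 / real (Suc k)\<close> to \<open>x\<close> has a ball of that radius which
      contains \<open>x\<close> and stays inside \<open>mball x r\<close>.\<close>
    obtain k where k: "1 / real (Suc k) < r / 2"
      using r(1) by (metis half_gt_zero nat_approx_posE)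
    have "x \<in> mtopology closure_of C"
      using x C(3) by simp
    moreover have "0 < 1 / real (Suc k)"
      by simp
    ultimately obtain c where c: "c \<in> C" "c \<in> mball x (1 / real (Suc k))"
      unfolding metric_closure_of by blast
    have "x \<in> mball c (1 / real (Suc k))"
      using c(2) by (simp add: commute)
    moreover have "mball c (1 / real (Suc k)) \<subseteq> mball x r"
    proof (rule mball_subset)
      show "d c x + 1 / real (Suc k) \<le> r"
        using c(2) k commute[of c x] by simp
    qed (use x in simp)
    ultimately show "\<exists>V\<in>B. x \<in> V \<and> V \<subseteq> U"
      using c(1) r(2) unfolding B_def by (intro bexI[of _ "mball c (1 / real (Suc k))"]) auto
  qed
qed

lemma borel_of_open: "openin T U \<Longrightarrow> U \<in> sets (borel_of T)"
  by (simp add: sets_borel_of sigma_sets.Basic)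

lemma borel_of_closed: "closedin T U \<Longrightarrow> U \<in> sets (borel_of T)"
  by (metis borel_of_open closedin_def openin_closedin_eq sets.compl_sets space_borel_of
      double_diff subset_refl)

lemma borel_prob_onD:
  assumes "borel_prob_on T N"
  shows "prob_space N" "sets N = sets (borel_of T)" "space N = topspace T"
  using assms sets_eq_imp_space_eq[of N "borel_of T"] by (auto simp: borel_prob_on_def)

text \<open>Ulam's theorem. For every \<open>k\<close>, finitely many closed balls of radius
  \<open>1 / real (Suc k)\<close> around points of a dense sequence carry all but
  \<open>e * (1 / 2) ^ Suc k\<close> of the mass. Their unions intersect, over all \<open>k\<close>,
  in a closed and totally bounded set, which is compact by completeness; the losses sum to
  \<open>e\<close>.\<close>

lemma polish_tight:
  assumes T: "polish_topology T" and N: "borel_prob_on T N" and e: "e > (0 :: real)"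
  obtains K where "compactin T K" "measure N (topspace T - K) \<le> e"
proof -
  obtain M d where "Metric_space M d" and comp: "Metric_space.mcomplete M d"
    and Td: "T = Metric_space.mtopology M d"
    using T by (auto simp: polish_topology_def completely_metrizable_space_def)
  interpret Metric_space M d by fact
  obtain C where C: "countable C" "C \<subseteq> M" "mtopology closure_of C = M"
    using T by (auto simp: Td polish_topology_def separable_space_def)
  interpret N: prob_space N
    using N by (rule borel_prob_onD)
  have spN: "space N = M" and sN: "sets N = sets (borel_of mtopology)"
    using borel_prob_onD[OF N] by (auto simp: Td)
  have "C \<noteq> {}"
    using N.not_empty C(3) spN by auto
  \<comment> \<open>An enumeration of the dense set, possibly with repetitions; the set is nonempty
    because a probability space is.\<close>
  define q where "q = from_nat_into C"
  have q: "range q = C"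
    using \<open>C \<noteq> {}\<close> C(1) by (simp add: q_def range_from_nat_into)
  define A where "A = (\<lambda>k m. \<Union>j\<in>{..m :: nat}. mcball (q j) (1 / real (Suc k)))"
  have Acl: "closedin mtopology (A k m)" for k m
    unfolding A_def by (intro closedin_Union) auto
  have Am: "A k m \<in> sets N" for k m
    using borel_of_closed[OF Acl] by (simp add: sN)
  have AM: "A k m \<subseteq> M" for k m
    using closedin_subset[OF Acl] by simp
  have "\<exists>m. measure N (M - A k m) \<le> e * (1 / 2) ^ Suc k" for k
  proof -
    have "(\<Union>m. A k m) = M"
    proof
      show "M \<subseteq> (\<Union>m. A k m)"
      proof
        fix x assume x: "x \<in> M"
        then have "x \<in> mtopology closure_of C"
          using C(3) by simp
        moreover have "0 < 1 / real (Suc k)"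
          by simp
        ultimately obtain c where c: "c \<in> C" "c \<in> mball x (1 / real (Suc k))"
          unfolding metric_closure_of by blast
        obtain j where "c = q j"
          using c(1) q by auto
        then have "x \<in> mcball (q j) (1 / real (Suc k))"
          using c(2) by (simp add: commute)
        then show "x \<in> (\<Union>m. A k m)"
          by (auto simp: A_def)
      qed
    qed (use AM in auto)
    moreover have "incseq (A k)"
      unfolding A_def incseq_def by (intro allI impI UN_mono) auto
    then have "(\<lambda>m. measure N (A k m)) \<longlonglongrightarrow> measure N (\<Union>m. A k m)"
      by (intro N.finite_Lim_measure_incseq) (use Am in auto)
    ultimately have "(\<lambda>m. measure N (A k m)) \<longlonglongrightarrow> 1"
      using N.prob_space spN by simp
    then have "eventually (\<lambda>m. measure N (A k m) > 1 - e * (1 / 2) ^ Suc k) sequentially"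
      by (rule order_tendstoD) (use e in simp)
    then obtain m where "measure N (A k m) > 1 - e * (1 / 2) ^ Suc k"
      by (metis eventually_happens' sequentially_bot)
    then have "measure N (M - A k m) \<le> e * (1 / 2) ^ Suc k"
      using N.prob_compl[OF Am, of k m] spN by simp
    then show ?thesis ..
  qed
  then obtain m where m: "\<And>k. measure N (M - A k (m k)) \<le> e * (1 / 2) ^ Suc k"
    by metis
  define K where "K = (\<Inter>k. A k (m k))"
  have Kcl: "closedin mtopology K"
    unfolding K_def using Acl by (intro closedin_Inter) auto
  have "mtotally_bounded K"
    unfolding mtotally_bounded_def
  proof (intro allI impI)
    fix r :: real assume "r > 0"
    then obtain k where k: "1 / real (Suc k) < r / 2"
      by (metis half_gt_zero nat_approx_posE)
    \<comment> \<open>Total boundedness asks for centres inside \<open>K\<close>, while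
      \<open>q j\<close> may lie outside. Each ball that meets \<open>K\<close> is replaced by one
      around a point \<open>p j\<close> of \<open>K\<close> in it, which doubles the radius; hence
      the choice of \<open>k\<close> with \<open>r / 2\<close>.\<close>
    define J where "J = {j \<in> {..m k}. K \<inter> mcball (q j) (1 / real (Suc k)) \<noteq> {}}"
    have "\<forall>j\<in>J. \<exists>p. p \<in> K \<inter> mcball (q j) (1 / real (Suc k))"
      by (auto simp: J_def)
    then obtain p where p: "\<And>j. j \<in> J \<Longrightarrow> p j \<in> K \<inter> mcball (q j) (1 / real (Suc k))"
      by metis
    have "K \<subseteq> (\<Union>x\<in>p ` J. mball x r)"
    proof
      fix x assume x: "x \<in> K"
      then obtain j where j: "j \<le> m k" "x \<in> mcball (q j) (1 / real (Suc k))"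
        by (auto simp: K_def A_def)
      then have J: "j \<in> J"
        using x by (auto simp: J_def)
      have "d (p j) x \<le> d (p j) (q j) + d (q j) x"
        by (rule triangle) (use p[OF J] j in auto)
      also have "\<dots> < r"
        using p[OF J] j(2) k commute[of "p j" "q j"] by auto
      finally have "x \<in> mball (p j) r"
        using p[OF J] j(2) by auto
      then show "x \<in> (\<Union>x\<in>p ` J. mball x r)"
        using J by blast
    qed
    then show "\<exists>F. finite F \<and> F \<subseteq> K \<and> K \<subseteq> (\<Union>x\<in>F. mball x r)"
      using p by (intro exI[of _ "p ` J"]) (auto simp: J_def)
  qed
  then have "compactin T K"
    using mtotally_bounded_eq_compact_closure_of[OF comp] Kcl closure_of_eq[of mtopology K]
    by (simp add: Td)
  moreover have "measure N (topspace T - K) \<le> e"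
  proof -
    have sm: "(\<lambda>k. e * (1 / 2) ^ Suc k) sums (e * 1)"
      using power_half_series by (rule sums_mult)
    have sm': "summable (\<lambda>k. measure N (M - A k (m k)))"
      by (rule summable_comparison_test'[OF sums_summable[OF sm], of 0]) (use m in auto)
    have "topspace T - K = (\<Union>k. M - A k (m k))"
      by (auto simp: K_def Td)
    then have "measure N (topspace T - K) \<le> (\<Sum>k. measure N (M - A k (m k)))"
      using N.finite_measure_subadditive_countably[OF _ sm'] Am spN
      by (metis (no_types, lifting) image_subsetI sets.compl_sets)
    also have "\<dots> \<le> (\<Sum>k. e * (1 / 2) ^ Suc k)"
      by (rule suminf_le[OF _ sm' sums_summable[OF sm]]) (rule m)
    also have "\<dots> = e"
      using sums_unique[OF sm] by simp
    finally show ?thesis .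
  qed
  ultimately show ?thesis
    by (rule that)
qed

text \<open>In a metrizable space open and closed sets are F-sigma, so ascending closed sets exhaust
  \<open>U\<close> in measure; intersecting one of them with a compact set from tightness gives
  \<open>K\<close>. Each of the two approximations costs \<open>e / 2\<close>.\<close>

lemma polish_inner_regular:
  assumes T: "polish_topology T" and N: "borel_prob_on T N" and e: "e > (0 :: real)"
    and U: "openin T U \<or> closedin T U"
  obtains K where "compactin T K" "K \<subseteq> U" "measure N (U - K) \<le> e"
proof -
  interpret N: prob_space N
    using N by (rule borel_prob_onD)
  have spN: "space N = topspace T" and sN: "sets N = sets (borel_of T)"
    using borel_prob_onD[OF N] by auto
  have metr: "metrizable_space T"
    using T by (simp add: polish_topology_def completely_metrizable_imp_metrizable_space)
  have "fsigma_in T U"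
    using U open_imp_fsigma_in[OF metr] closed_imp_fsigma_in by blast
  then obtain C where C: "\<And>k. closedin T (C k)" "\<And>k. C k \<subseteq> C (Suc k)" "(\<Union>k. C k) = U"
    unfolding fsigma_in_ascending by auto
  have Cm: "C k \<in> sets N" for k
    using borel_of_closed[OF C(1)] by (simp add: sN)
  have Um: "U \<in> sets N"
    using Cm C(3) by auto
  obtain L where L: "compactin T L" "measure N (topspace T - L) \<le> e / 2"
    using polish_tight[OF T N, of "e / 2"] e by auto
  have Lcl: "closedin T L"
    using L(1) metr by (simp add: compactin_imp_closedin metrizable_imp_Hausdorff_space)
  then have Lm: "L \<in> sets N"
    using borel_of_closed by (auto simp: sN)
  have "(\<lambda>k. measure N (C k)) \<longlonglongrightarrow> measure N (\<Union>k. C k)"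
    by (rule N.finite_Lim_measure_incseq) (use Cm C(2) in \<open>auto intro: incseq_SucI\<close>)
  then have "eventually (\<lambda>k. measure N (C k) > measure N U - e / 2) sequentially"
    unfolding C(3) by (rule order_tendstoD) (use e in simp)
  then obtain k where k: "measure N (C k) > measure N U - e / 2"
    by (metis eventually_happens' sequentially_bot)
  show ?thesis
  proof (rule that[of "C k \<inter> L"])
    show "compactin T (C k \<inter> L)"
      using closed_Int_compactin[OF C(1) L(1)] .
    show CU: "C k \<inter> L \<subseteq> U"
      using C(3) by auto
    have "U - C k \<inter> L \<subseteq> (U - C k) \<union> (space N - L)"
      using sets.sets_into_space[OF Um] by auto
    then have "measure N (U - C k \<inter> L) \<le> measure N ((U - C k) \<union> (space N - L))"
      by (rule N.finite_measure_mono) (use Um Cm Lm in auto)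
    also have "\<dots> \<le> measure N (U - C k) + measure N (space N - L)"
      by (rule measure_Un_le) (use Um Cm Lm in auto)
    also have "measure N (U - C k) = measure N U - measure N (C k)"
      by (rule N.finite_measure_Diff) (use Um Cm C(3) in auto)
    finally show "measure N (U - C k \<inter> L) \<le> e"
      using k L(2) spN by simp
  qed
qed

section \<open>Sets approximable uniformly over all couplings\<close>

locale polish_marginals =
  fixes n :: nat and X :: "nat \<Rightarrow> 'a topology" and \<mu> :: "nat \<Rightarrow> 'a measure"
  assumes polish: "\<And>i. i \<in> {1..n} \<Longrightarrow> polish_topology (X i)"
    and prob: "\<And>i. i \<in> {1..n} \<Longrightarrow> borel_prob_on (X i) (\<mu> i)"
begin

declare One_nat_def [simp del]

abbreviation "P \<equiv> prod_top n X"

abbreviation "cyl i B \<equiv> {x \<in> topspace P. x i \<in> B}"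

lemma Hausdorff_X: "i \<in> {1..n} \<Longrightarrow> Hausdorff_space (X i)"
  using polish unfolding polish_topology_def
  by (blast intro: completely_metrizable_imp_metrizable_space metrizable_imp_Hausdorff_space)

lemma Hausdorff_P: "Hausdorff_space P"
  using Hausdorff_X unfolding Hausdorff_space_product_topology by blast

lemma compactin_P_closedin: "compactin P C \<Longrightarrow> closedin P C"
  using Hausdorff_P by (rule compactin_imp_closedin)

lemma compactin_P_sets: "compactin P C \<Longrightarrow> C \<in> sets (borel_of P)"
  using compactin_P_closedin borel_of_closed by blast

lemma couplingsD:
  assumes "\<rho> \<in> couplings n X \<mu>"
  shows "prob_space \<rho>" "sets \<rho> = sets (borel_of P)" "space \<rho> = topspace P"
  using assms borel_prob_onD[of P \<rho>] by (auto simp: couplings_def)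

lemma measurable_component:
  assumes "i \<in> {1..n}" "sets \<rho> = sets (borel_of P)"
  shows "(\<lambda>x. x i) \<in> \<rho> \<rightarrow>\<^sub>M borel_of (X i)"
  using continuous_map_measurable_borel_of[OF continuous_map_product_projection[OF assms(1), of X]]
  unfolding measurable_cong_sets[OF assms(2) refl] .

lemma measure_cyl:
  assumes \<rho>: "\<rho> \<in> couplings n X \<mu>" and i: "i \<in> {1..n}" and B: "B \<in> sets (borel_of (X i))"
  shows "measure \<rho> (cyl i B) = measure (\<mu> i) B"
proof -
  have "measure (distr \<rho> (borel_of (X i)) (\<lambda>x. x i)) B = measure \<rho> ((\<lambda>x. x i) -` B \<inter> space \<rho>)"
    using measurable_component[OF i couplingsD(2)[OF \<rho>]] B by (rule measure_distr)
  moreover have "(\<lambda>x. x i) -` B \<inter> space \<rho> = cyl i B"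
    using couplingsD(3)[OF \<rho>] by auto
  ultimately show ?thesis
    using \<rho> i by (simp add: couplings_def)
qed

lemma cyl_sets:
  assumes i: "i \<in> {1..n}" and B: "B \<in> sets (borel_of (X i))"
  shows "cyl i B \<in> sets (borel_of P)"
proof -
  have "(\<lambda>x. x i) -` B \<inter> space (borel_of P) \<in> sets (borel_of P)"
    using measurable_component[OF i refl] B by (rule measurable_sets)
  moreover have "(\<lambda>x. x i) -` B \<inter> space (borel_of P) = cyl i B"
    by auto
  ultimately show ?thesis
    by simp
qed

text \<open>The compact set must not depend on the coupling; this uniformity survives in limits of couplings.\<close>

definition ureg :: "(nat \<Rightarrow> 'a) set \<Rightarrow> bool" where
  "ureg A \<longleftrightarrow> A \<in> sets (borel_of P) \<and>
    (\<forall>e>0. \<exists>C. compactin P C \<and> C \<subseteq> A \<and> (\<forall>\<rho>\<in>couplings n X \<mu>. measure \<rho> (A - C) \<le> e))"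

lemma ureg_sets: "ureg A \<Longrightarrow> A \<in> sets (borel_of P)"
  by (simp add: ureg_def)

lemma uregE:
  assumes "ureg A" "e > 0"
  obtains C where "compactin P C" "C \<subseteq> A"
    "\<And>\<rho>. \<rho> \<in> couplings n X \<mu> \<Longrightarrow> measure \<rho> (A - C) \<le> e"
  using assms by (auto simp: ureg_def)

text \<open>Shared by union and intersection: by \<open>op\<close>, whatever \<open>E\<close> misses
  of \<open>AB\<close> is missed by \<open>C\<close> in \<open>A\<close> or by \<open>D\<close> in
  \<open>B\<close>, so two errors of \<open>e / 2\<close> add up to \<open>e\<close>, for all
  couplings at once.\<close>

lemma ureg_combine:
  assumes A: "ureg A" and B: "ureg B" and AB: "AB \<in> sets (borel_of P)"
    and op: "\<And>C D. compactin P C \<Longrightarrow> C \<subseteq> A \<Longrightarrow> compactin P D \<Longrightarrow> D \<subseteq> B \<Longrightarrow>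
      \<exists>E. compactin P E \<and> E \<subseteq> AB \<and> AB - E \<subseteq> (A - C) \<union> (B - D)"
  shows "ureg AB"
  unfolding ureg_def
proof (intro conjI allI impI AB)
  fix e :: real assume e: "e > 0"
  obtain C where C: "compactin P C" "C \<subseteq> A"
      "\<And>\<rho>. \<rho> \<in> couplings n X \<mu> \<Longrightarrow> measure \<rho> (A - C) \<le> e / 2"
    using uregE[OF A, of "e / 2"] e by auto
  obtain D where D: "compactin P D" "D \<subseteq> B"
      "\<And>\<rho>. \<rho> \<in> couplings n X \<mu> \<Longrightarrow> measure \<rho> (B - D) \<le> e / 2"
    using uregE[OF B, of "e / 2"] e by auto
  obtain E where E: "compactin P E" "E \<subseteq> AB" "AB - E \<subseteq> (A - C) \<union> (B - D)"
    using op[OF C(1,2) D(1,2)] by auto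
  have "measure \<rho> (AB - E) \<le> e" if \<rho>: "\<rho> \<in> couplings n X \<mu>" for \<rho>
  proof -
    interpret \<rho>: prob_space \<rho>
      using \<rho> by (rule couplingsD)
    have m: "A - C \<in> sets \<rho>" "B - D \<in> sets \<rho>"
      using ureg_sets[OF A] ureg_sets[OF B] compactin_P_sets C(1) D(1) couplingsD(2)[OF \<rho>]
      by auto
    have "measure \<rho> (AB - E) \<le> measure \<rho> ((A - C) \<union> (B - D))"
      by (rule \<rho>.finite_measure_mono) (use E m in auto)
    also have "\<dots> \<le> measure \<rho> (A - C) + measure \<rho> (B - D)"
      by (rule measure_Un_le) (use m in auto)
    finally show ?thesis
      using C(3)[OF \<rho>] D(3)[OF \<rho>] by simp
  qed
  then show "\<exists>C. compactin P C \<and> C \<subseteq> AB \<and> (\<forall>\<rho>\<in>couplings n X \<mu>. measure \<rho> (AB - C) \<le> e)"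
    using E by blast
qed

lemma ureg_Un:
  assumes A: "ureg A" and B: "ureg B"
  shows "ureg (A \<union> B)"
proof (rule ureg_combine[OF A B])
  show "A \<union> B \<in> sets (borel_of P)"
    using ureg_sets[OF A] ureg_sets[OF B] by (rule sets.Un)
  fix C D assume "compactin P C" "C \<subseteq> A" "compactin P D" "D \<subseteq> B"
  then show "\<exists>E. compactin P E \<and> E \<subseteq> A \<union> B \<and> A \<union> B - E \<subseteq> (A - C) \<union> (B - D)"
    by (intro exI[of _ "C \<union> D"] conjI compactin_Un) auto
qed

lemma ureg_Int:
  assumes A: "ureg A" and B: "ureg B"
  shows "ureg (A \<inter> B)"
proof (rule ureg_combine[OF A B])
  show "A \<inter> B \<in> sets (borel_of P)"
    using ureg_sets[OF A] ureg_sets[OF B] by (rule sets.Int)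
  fix C D assume "compactin P C" "C \<subseteq> A" "compactin P D" "D \<subseteq> B"
  then show "\<exists>E. compactin P E \<and> E \<subseteq> A \<inter> B \<and> A \<inter> B - E \<subseteq> (A - C) \<union> (B - D)"
    by (intro exI[of _ "C \<inter> D"] conjI compact_Int_closedin compactin_P_closedin) auto
qed

text \<open>The source of all uniformity. A point of the box over \<open>V\<close> outside the box
  over \<open>K\<close> has some coordinate in \<open>V j - K j\<close>, and every coupling gives
  that cylinder the same mass, namely the one prescribed by the marginal.\<close>

lemma exhausting_box:
  assumes V: "\<And>j. j \<in> {1..n} \<Longrightarrow> openin (X j) (V j) \<or> closedin (X j) (V j)" and e: "e > (0 :: real)"
  obtains K where "\<And>j. j \<in> {1..n} \<Longrightarrow> compactin (X j) (K j)" "\<And>j. j \<in> {1..n} \<Longrightarrow> K j \<subseteq> V j"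
    "\<And>\<rho>. \<rho> \<in> couplings n X \<mu> \<Longrightarrow> measure \<rho> (PiE {1..n} V - PiE {1..n} K) \<le> e"
proof -
  \<comment> \<open>There are \<open>n\<close> coordinates, so errors of
    \<open>e / real (Suc n)\<close> sum to at most \<open>e\<close>; \<open>Suc n\<close> keeps the
    error positive when \<open>n\<close> is 0, where division by \<open>real n\<close> would give
    0.\<close>
  have "\<exists>K. compactin (X j) K \<and> K \<subseteq> V j \<and> measure (\<mu> j) (V j - K) \<le> e / real (Suc n)"
    if j: "j \<in> {1..n}" for j
  proof -
    have "e / real (Suc n) > 0"
      using e by simp
    then show ?thesis
      using polish_inner_regular[OF polish[OF j] prob[OF j] _ V[OF j]] by metis
  qed
  then obtain K where K: "\<And>j. j \<in> {1..n} \<Longrightarrow> compactin (X j) (K j)"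
      "\<And>j. j \<in> {1..n} \<Longrightarrow> K j \<subseteq> V j"
      "\<And>j. j \<in> {1..n} \<Longrightarrow> measure (\<mu> j) (V j - K j) \<le> e / real (Suc n)"
    by metis
  show ?thesis
  proof (rule that[OF K(1,2)])
    fix \<rho> assume \<rho>: "\<rho> \<in> couplings n X \<mu>"
    interpret \<rho>: prob_space \<rho>
      using \<rho> by (rule couplingsD)
    have VK: "V j - K j \<in> sets (borel_of (X j))" if j: "j \<in> {1..n}" for j
      using V[OF j] borel_of_closed[OF compactin_imp_closedin[OF Hausdorff_X[OF j] K(1)[OF j]]]
        borel_of_open[of "X j" "V j"] borel_of_closed[of "X j" "V j"] by auto
    have cm: "cyl j (V j - K j) \<in> sets \<rho>" if "j \<in> {1..n}" for j
      using cyl_sets[OF that VK[OF that]] couplingsD(2)[OF \<rho>] by simp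
    have "PiE {1..n} V - PiE {1..n} K \<subseteq> (\<Union>j\<in>{1..n}. cyl j (V j - K j))"
    proof
      fix x assume x: "x \<in> PiE {1..n} V - PiE {1..n} K"
      then obtain j where "j \<in> {1..n}" "x j \<notin> K j"
        by (auto simp: PiE_iff)
      moreover have "V j \<subseteq> topspace (X j)" if "j \<in> {1..n}" for j
        using V[OF that] openin_subset closedin_subset by blast
      then have "PiE {1..n} V \<subseteq> topspace P"
        unfolding topspace_product_topology by (rule PiE_mono)
      ultimately show "x \<in> (\<Union>j\<in>{1..n}. cyl j (V j - K j))"
        using x by (auto dest: PiE_mem)
    qed
    then have "measure \<rho> (PiE {1..n} V - PiE {1..n} K)
        \<le> measure \<rho> (\<Union>j\<in>{1..n}. cyl j (V j - K j))"
      by (rule \<rho>.finite_measure_mono) (use cm in auto)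
    also have "\<dots> \<le> (\<Sum>j\<in>{1..n}. measure \<rho> (cyl j (V j - K j)))"
      by (rule \<rho>.finite_measure_subadditive_finite) (use cm in auto)
    also have "\<dots> \<le> (\<Sum>j\<in>{1..n}. e / real (Suc n))"
      by (rule sum_mono) (use measure_cyl[OF \<rho> _ VK] K(3) in simp)
    also have "\<dots> \<le> e"
      using e by (simp add: field_simps)
    finally show "measure \<rho> (PiE {1..n} V - PiE {1..n} K) \<le> e" .
  qed
qed

text \<open>Written with complements and a finite union, the identity also covers an empty index
  set, and reduces boxes to cylinders in any algebra. It serves both the Borel sets and
  \<open>biregular\<close>.\<close>

lemma PiE_eq_Diff_cyl:
  assumes "\<And>j. j \<in> {1..n} \<Longrightarrow> V j \<subseteq> topspace (X j)"
  shows "PiE {1..n} V = topspace P - (\<Union>j\<in>{1..n}. topspace P - cyl j (V j))"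
proof
  show "PiE {1..n} V \<subseteq> topspace P - (\<Union>j\<in>{1..n}. topspace P - cyl j (V j))"
    using PiE_mono[of "{1..n}" V "\<lambda>j. topspace (X j)"] assms by (auto dest: PiE_mem)
qed (auto simp: PiE_iff)

lemma PiE_sets:
  assumes "\<And>j. j \<in> {1..n} \<Longrightarrow> V j \<in> sets (borel_of (X j))"
  shows "PiE {1..n} V \<in> sets (borel_of P)"
proof -
  have "V j \<subseteq> topspace (X j)" if "j \<in> {1..n}" for j
    using sets.sets_into_space[OF assms[OF that]] by simp
  then have "PiE {1..n} V = topspace P - (\<Union>j\<in>{1..n}. topspace P - cyl j (V j))"
    by (rule PiE_eq_Diff_cyl)
  also have "\<dots> \<in> sets (borel_of P)"
    by (intro sets.Diff sets.finite_UN cyl_sets assms)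
      (use sets.top[of "borel_of P"] in \<open>simp_all only: space_borel_of finite_atLeastAtMost\<close>)
  finally show ?thesis .
qed

lemma ureg_box:
  assumes V: "\<And>j. j \<in> {1..n} \<Longrightarrow> openin (X j) (V j) \<or> closedin (X j) (V j)"
  shows "ureg (PiE {1..n} V)"
  unfolding ureg_def
proof (intro conjI allI impI)
  show "PiE {1..n} V \<in> sets (borel_of P)"
    by (rule PiE_sets) (use V borel_of_open borel_of_closed in blast)
  fix e :: real assume "e > 0"
  then obtain K where "\<And>j. j \<in> {1..n} \<Longrightarrow> compactin (X j) (K j)"
      "\<And>j. j \<in> {1..n} \<Longrightarrow> K j \<subseteq> V j"
      "\<And>\<rho>. \<rho> \<in> couplings n X \<mu> \<Longrightarrow> measure \<rho> (PiE {1..n} V - PiE {1..n} K) \<le> e"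
    using exhausting_box[OF V] by metis
  then show "\<exists>C. compactin P C \<and> C \<subseteq> PiE {1..n} V \<and>
      (\<forall>\<rho>\<in>couplings n X \<mu>. measure \<rho> (PiE {1..n} V - C) \<le> e)"
    by (intro exI[of _ "PiE {1..n} K"] conjI PiE_mono) (simp_all add: compactin_PiE)
qed

section \<open>The algebra of biregular sets\<close>

definition biregular :: "(nat \<Rightarrow> 'a) set set" where
  "biregular = {A. ureg A \<and> ureg (topspace P - A)}"

lemma biregular_sets: "A \<in> biregular \<Longrightarrow> A \<in> sets (borel_of P)"
  by (simp add: biregular_def ureg_sets)

lemma biregular_subset: "A \<in> biregular \<Longrightarrow> A \<subseteq> topspace P"
  using biregular_sets sets.sets_into_space by fastforce

lemma ureg_topspace: "ureg (topspace P)"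
  unfolding topspace_product_topology by (rule ureg_box) simp

lemma ureg_empty: "ureg {}"
  by (auto simp: ureg_def)

text \<open>Uniform inner regularity passes to finite unions and intersections, but there is no rule
  for complements. Imposing it on the complement as well makes the class symmetric, and De Morgan's
  law gives closure under unions.\<close>

lemma algebra_biregular: "algebra (topspace P) biregular"
  unfolding algebra_iff_Un
proof (intro conjI ballI)
  show "biregular \<subseteq> Pow (topspace P)"
    using biregular_subset by blast
  show "{} \<in> biregular"
    using ureg_topspace ureg_empty unfolding biregular_def by simp
  show "topspace P - A \<in> biregular" if "A \<in> biregular" for A
    using that biregular_subset[OF that] unfolding biregular_def by (simp add: double_diff)
  show "A \<union> B \<in> biregular" if "A \<in> biregular" "B \<in> biregular" for A B
    using that unfolding biregular_def by (simp add: ureg_Un ureg_Int Diff_Un)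
qed

sublocale biregular: algebra "topspace P" biregular
  by (rule algebra_biregular)

lemma cyl_biregular:
  assumes i: "i \<in> {1..n}" and U: "openin (X i) U \<or> closedin (X i) U"
  shows "cyl i U \<in> biregular"
proof -
  have *: "ureg (cyl i U)" if U: "openin (X i) U \<or> closedin (X i) U" for U
  proof -
    have "U \<subseteq> topspace (X i)"
      using U openin_subset closedin_subset by blast
    then have "cyl i U = PiE {1..n} (\<lambda>j. if j = i then U else topspace (X j))"
      using i unfolding topspace_product_topology PiE_iff set_eq_iff mem_Collect_eq
      by (metis subsetD)
    also have "ureg \<dots>"
      by (rule ureg_box) (use U in \<open>simp split: if_split\<close>)
    finally show ?thesis .
  qed
  have "topspace P - cyl i U = cyl i (topspace (X i) - U)"
    using i by auto
  moreover have "openin (X i) (topspace (X i) - U) \<or> closedin (X i) (topspace (X i) - U)"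
    using U closedin_diff[OF closedin_topspace, of "X i" U] openin_diff[OF openin_topspace, of "X i" U]
    by argo
  ultimately show ?thesis
    unfolding biregular_def mem_Collect_eq using *[OF U] *[of "topspace (X i) - U"] by argo
qed

text \<open>The complement of a box is in general not a box, so \<open>ureg_box\<close> does not
  settle it; it is a finite union of complements of cylinders, which the algebra contains.\<close>

lemma box_biregular:
  assumes V: "\<And>j. j \<in> {1..n} \<Longrightarrow> openin (X j) (V j) \<or> closedin (X j) (V j)"
  shows "PiE {1..n} V \<in> biregular"
proof -
  have "V j \<subseteq> topspace (X j)" if "j \<in> {1..n}" for j
    using V[OF that] openin_subset closedin_subset by blast
  then have "PiE {1..n} V = topspace P - (\<Union>j\<in>{1..n}. topspace P - cyl j (V j))"
    by (rule PiE_eq_Diff_cyl)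
  also have "\<dots> \<in> biregular"
    by (intro biregular.Diff biregular.top biregular.finite_UN cyl_biregular V finite_atLeastAtMost)
  finally show ?thesis .
qed

text \<open>Every open set of the product is the union of the boxes inside it whose sides come from
  countable bases, and there are only countably many such boxes. Hence a measure extended from
  \<open>biregular\<close> is defined on all Borel sets.\<close>

lemma sigma_sets_biregular: "sigma_sets (topspace P) biregular = sets (borel_of P)"
proof
  show "sigma_sets (topspace P) biregular \<subseteq> sets (borel_of P)"
    using sets.sigma_sets_subset[of biregular "borel_of P"] biregular_sets by auto
  have "\<exists>B. countable B \<and> (\<forall>V\<in>B. openin (X j) V) \<and>
      (\<forall>U x. openin (X j) U \<and> x \<in> U \<longrightarrow> (\<exists>V\<in>B. x \<in> V \<and> V \<subseteq> U))" if "j \<in> {1..n}" for j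
    using polish[OF that] separable_metrizable_imp_second_countable[of "X j"]
    by (simp add: polish_topology_def completely_metrizable_imp_metrizable_space
        second_countable_def)
  then obtain B where B: "\<And>j. j \<in> {1..n} \<Longrightarrow> countable (B j)"
      "\<And>j V. j \<in> {1..n} \<Longrightarrow> V \<in> B j \<Longrightarrow> openin (X j) V"
      "\<And>j U x. j \<in> {1..n} \<Longrightarrow> openin (X j) U \<Longrightarrow> x \<in> U \<Longrightarrow> \<exists>V\<in>B j. x \<in> V \<and> V \<subseteq> U"
    by metis
  have "U \<in> sigma_sets (topspace P) biregular" if U: "openin P U" for U
  proof -
    define \<B> where "\<B> = {W \<in> PiE {1..n} ` PiE {1..n} B. W \<subseteq> U}"
    have "countable \<B>"
      unfolding \<B>_def using B(1) by (intro countable_Collect countable_image countable_PiE) auto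
    moreover have "W \<in> sigma_sets (topspace P) biregular" if "W \<in> \<B>" for W
      using that B(2) unfolding \<B>_def by (auto intro!: sigma_sets.Basic box_biregular dest: PiE_mem)
    moreover have "U = \<Union>\<B>"
    proof
      show "U \<subseteq> \<Union>\<B>"
      proof
        fix x assume "x \<in> U"
        then obtain V where V: "\<And>j. j \<in> {1..n} \<Longrightarrow> openin (X j) (V j)"
            "x \<in> PiE {1..n} V" "PiE {1..n} V \<subseteq> U"
          using U unfolding openin_product_topology_alt by metis
        have "\<exists>W\<in>B j. x j \<in> W \<and> W \<subseteq> V j" if "j \<in> {1..n}" for j
          using B(3)[OF that V(1)[OF that]] V(2) that by (auto dest: PiE_mem)
        then obtain W where W: "\<And>j. j \<in> {1..n} \<Longrightarrow> W j \<in> B j \<and> x j \<in> W j \<and> W j \<subseteq> V j"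
          by metis
        \<comment> \<open>Membership in \<open>PiE {1..n} B\<close> fixes the values outside the
          index set; restricting \<open>W\<close> achieves this without changing the box.\<close>
        have "PiE {1..n} W = PiE {1..n} (restrict W {1..n})"
          by (rule PiE_cong) simp
        moreover have "restrict W {1..n} \<in> PiE {1..n} B"
          using W by simp
        moreover have "PiE {1..n} W \<subseteq> U"
          using PiE_mono[of "{1..n}" W V] W V(3) by auto
        ultimately have "PiE {1..n} W \<in> \<B>"
          unfolding \<B>_def by (metis (no_types, lifting) image_eqI mem_Collect_eq)
        moreover have "x \<in> PiE {1..n} W"
          using W V(2) by (auto simp: PiE_iff)
        ultimately show "x \<in> \<Union>\<B>"
          by blast
      qed
    qed (auto simp: \<B>_def)
    ultimately show ?thesis
      by (metis sigma_sets_UNION)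
  qed
  then show "sets (borel_of P) \<subseteq> sigma_sets (topspace P) biregular"
    unfolding sets_borel_of by (intro sigma_sets_mono) auto
qed

section \<open>Limits of couplings\<close>

text \<open>A setwise limit of measures along a filter is a priori only finitely additive. Uniform
  regularity makes it continuous at the empty set on \<open>biregular\<close>, and Caratheodory's
  theorem extends it from there. The extension is claimed to agree with \<open>\<nu>\<close> on that
  algebra only.\<close>

lemma coupling_of_limit:
  assumes F: "F \<noteq> bot" "eventually (\<lambda>\<rho>. \<rho> \<in> couplings n X \<mu>) F"
    and lim: "\<And>A. A \<in> sets (borel_of P) \<Longrightarrow> ((\<lambda>\<rho>. measure \<rho> A) \<longlongrightarrow> \<nu> A) F"
  obtains \<pi> where "\<pi> \<in> couplings n X \<mu>" "\<And>A. A \<in> biregular \<Longrightarrow> measure \<pi> A = \<nu> A"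
proof -
  have \<nu>_eqI: "\<nu> A = a"
    if "A \<in> sets (borel_of P)" "\<And>\<rho>. \<rho> \<in> couplings n X \<mu> \<Longrightarrow> measure \<rho> A = a" for A a
  proof -
    have "((\<lambda>\<rho>. measure \<rho> A) \<longlongrightarrow> a) F"
      by (rule tendsto_eventually) (use F(2) that(2) in \<open>auto elim: eventually_mono\<close>)
    then show ?thesis
      using tendsto_unique[OF F(1) lim[OF that(1)]] by blast
  qed
  have \<nu>_le: "\<nu> A \<le> a"
    if "A \<in> sets (borel_of P)" "\<And>\<rho>. \<rho> \<in> couplings n X \<mu> \<Longrightarrow> measure \<rho> A \<le> a" for A a
    by (rule tendsto_upperbound[OF lim[OF that(1)] _ F(1)])
      (use F(2) that(2) in \<open>auto elim: eventually_mono\<close>)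
  have \<nu>_nonneg: "0 \<le> \<nu> A" if "A \<in> sets (borel_of P)" for A
    by (rule tendsto_lowerbound[OF lim[OF that] _ F(1)]) simp
  have \<nu>_Un: "\<nu> (A \<union> B) = \<nu> A + \<nu> B"
    if "A \<in> biregular" "B \<in> biregular" "A \<inter> B = {}" for A B
  proof -
    have AB: "A \<in> sets (borel_of P)" "B \<in> sets (borel_of P)"
      using that biregular_sets by auto
    have "measure \<rho> (A \<union> B) = measure \<rho> A + measure \<rho> B" if "\<rho> \<in> couplings n X \<mu>" for \<rho>
    proof -
      interpret \<rho>: prob_space \<rho>
        using that by (rule couplingsD)
      show ?thesis
        by (rule \<rho>.finite_measure_Union) (use AB \<open>A \<inter> B = {}\<close> couplingsD(2)[OF that] in auto)
    qed
    then have "eventually (\<lambda>\<rho>. measure \<rho> A + measure \<rho> B = measure \<rho> (A \<union> B)) F"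
      using F(2) by (auto elim: eventually_mono)
    then have "((\<lambda>\<rho>. measure \<rho> (A \<union> B)) \<longlongrightarrow> \<nu> A + \<nu> B) F"
      using tendsto_add[OF lim[OF AB(1)] lim[OF AB(2)]] by (rule Lim_transform_eventually[rotated])
    then show ?thesis
      using tendsto_unique[OF F(1) lim] AB by blast
  qed
  have \<nu>_empty: "\<nu> {} = 0"
    by (rule \<nu>_eqI) auto
  have pos: "positive biregular (\<lambda>A. ennreal (\<nu> A))"
    using \<nu>_empty by (simp add: positive_def)
  have add: "additive biregular (\<lambda>A. ennreal (\<nu> A))"
    unfolding additive_def using \<nu>_Un \<nu>_nonneg biregular_sets by (simp add: ennreal_plus)
  have cont: "(\<lambda>k. ennreal (\<nu> (A k))) \<longlonglongrightarrow> 0"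
    if A: "range A \<subseteq> biregular" "decseq A" "(\<Inter>k. A k) = {}" for A :: "nat \<Rightarrow> _"
  proof -
    have Ab: "A k \<in> biregular" for k
      using A(1) by auto
    have As: "A k \<in> sets (borel_of P)" for k
      using biregular_sets[OF Ab] .
    \<comment> \<open>Choose compact \<open>C k\<close> inside \<open>A k\<close> with uniform error
      \<open>e * (1 / 2) ^ Suc k\<close>. The \<open>C k\<close> have empty intersection, so by
      compactness the first few already do. From that index \<open>N\<close> on, \<open>A j\<close>
      is covered by the sets \<open>A k - C k\<close> with \<open>k \<le> N\<close>, of total mass
      at most \<open>e\<close> under every coupling; this bound passes to
      \<open>\<nu>\<close>.\<close>
    have small: "\<exists>N. \<forall>k\<ge>N. \<nu> (A k) \<le> e" if e: "e > 0" for e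
    proof -
      have "\<exists>C. compactin P C \<and> C \<subseteq> A k \<and>
          (\<forall>\<rho>\<in>couplings n X \<mu>. measure \<rho> (A k - C) \<le> e * (1 / 2) ^ Suc k)" for k
      proof -
        have "ureg (A k)"
          using Ab[of k] by (simp add: biregular_def)
        moreover have "e * (1 / 2) ^ Suc k > 0"
          using e by simp
        ultimately show ?thesis
          by (rule uregE) blast
      qed
      then obtain C where C: "\<And>k. compactin P (C k)" "\<And>k. C k \<subseteq> A k"
          "\<And>k \<rho>. \<rho> \<in> couplings n X \<mu> \<Longrightarrow> measure \<rho> (A k - C k) \<le> e * (1 / 2) ^ Suc k"
        by metis
      have "\<exists>N. (\<Inter>k\<le>N. C k) = {}"
      proof (rule ccontr)
        assume ne: "\<not> (\<exists>N. (\<Inter>k\<le>N. C k) = {})"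
        have "(\<Inter>N. \<Inter>k\<le>N. C k) \<noteq> {}"
        proof (rule compact_space_imp_nest[of "subtopology P (C 0)"])
          show "compact_space (subtopology P (C 0))"
            using C(1) by (simp add: compactin_subspace)
          show "closedin (subtopology P (C 0)) (\<Inter>k\<le>N. C k)" for N
            using C(1) compactin_P_closedin by (intro closedin_subset_topspace closedin_INT) auto
          show "decseq (\<lambda>N. \<Inter>k\<le>N. C k)"
            unfolding decseq_def by (intro allI impI INF_superset_mono) auto
        qed (use ne in auto)
        moreover have "(\<Inter>N. \<Inter>k\<le>N. C k) \<subseteq> (\<Inter>k. A k)"
          using C(2) by fastforce
        ultimately show False
          using A(3) by simp
      qed
      then obtain N where N: "(\<Inter>k\<le>N. C k) = {}" ..
      have AC: "A j \<subseteq> (\<Union>k\<le>N. A k - C k)" if "j \<ge> N" for j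
      proof
        fix x assume x: "x \<in> A j"
        obtain k where k: "k \<le> N" "x \<notin> C k"
          using N by blast
        then have "x \<in> A k"
          using x decseqD[OF A(2), of k j] \<open>j \<ge> N\<close> by auto
        then show "x \<in> (\<Union>k\<le>N. A k - C k)"
          using k by blast
      qed
      have "\<nu> (A j) \<le> e" if "j \<ge> N" for j
      proof (rule \<nu>_le[OF As])
        fix \<rho> assume \<rho>: "\<rho> \<in> couplings n X \<mu>"
        interpret \<rho>: prob_space \<rho>
          using \<rho> by (rule couplingsD)
        have m: "A k - C k \<in> sets \<rho>" for k
          using As compactin_P_sets[OF C(1)] couplingsD(2)[OF \<rho>] by auto
        have "measure \<rho> (A j) \<le> measure \<rho> (\<Union>k\<le>N. A k - C k)"
          by (rule \<rho>.finite_measure_mono[OF AC[OF that]]) (use m in auto)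
        also have "\<dots> \<le> (\<Sum>k\<le>N. measure \<rho> (A k - C k))"
          by (rule \<rho>.finite_measure_subadditive_finite) (use m in auto)
        also have "\<dots> \<le> (\<Sum>k\<le>N. e * (1 / 2) ^ Suc k)"
          by (rule sum_mono) (rule C(3)[OF \<rho>])
        also have "\<dots> \<le> (\<Sum>k. e * (1 / 2) ^ Suc k)"
          by (rule sum_le_suminf[OF sums_summable[OF sums_mult[OF power_half_series]]])
            (use e in auto)
        also have "\<dots> = e"
          using sums_unique[OF sums_mult[OF power_half_series, of e]] by simp
        finally show "measure \<rho> (A j) \<le> e" .
      qed
      then show ?thesis
        by blast
    qed
    have "(\<lambda>k. \<nu> (A k)) \<longlonglongrightarrow> 0"
    proof (rule LIMSEQ_I)
      fix r :: real assume r: "r > 0"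
      then obtain N where "\<forall>k\<ge>N. \<nu> (A k) \<le> r / 2"
        using small[of "r / 2"] by auto
      then have "norm (\<nu> (A k) - 0) < r" if "k \<ge> N" for k
        using \<nu>_nonneg[OF As, of k] r that by force
      then show "\<exists>N. \<forall>k\<ge>N. norm (\<nu> (A k) - 0) < r"
        by blast
    qed
    then have "(\<lambda>k. ennreal (\<nu> (A k))) \<longlonglongrightarrow> ennreal 0"
      by (rule tendsto_ennrealI)
    then show ?thesis
      by simp
  qed
  have "\<exists>m. (\<forall>A\<in>biregular. m A = ennreal (\<nu> A)) \<and>
      measure_space (topspace P) (sigma_sets (topspace P) biregular) m"
    by (rule biregular.caratheodory_empty_continuous[OF pos add _ cont]) simp
  then obtain m where m: "\<And>A. A \<in> biregular \<Longrightarrow> m A = ennreal (\<nu> A)"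
      "measure_space (topspace P) (sigma_sets (topspace P) biregular) m"
    by blast
  define \<pi> where "\<pi> = measure_of (topspace P) (sets (borel_of P)) m"
  have spow: "sets (borel_of P) \<subseteq> Pow (topspace P)"
    using sets.space_closed[of "borel_of P"] by simp
  have sp: "space \<pi> = topspace P"
    unfolding \<pi>_def using spow by (rule space_measure_of)
  have se: "sets \<pi> = sets (borel_of P)"
    unfolding \<pi>_def sets_measure_of[OF spow]
    using sets.sigma_sets_eq[of "borel_of P"] by simp
  have "emeasure \<pi> A = m A" if "A \<in> sets (borel_of P)" for A
    using m(2) that unfolding \<pi>_def sigma_sets_biregular
    by (intro emeasure_measure_of_sigma) (auto simp: measure_space_def)
  then have em: "emeasure \<pi> A = ennreal (\<nu> A)" if "A \<in> biregular" for A
    using m(1)[OF that] biregular_sets[OF that] by simp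
  have me: "measure \<pi> A = \<nu> A" if "A \<in> biregular" for A
    unfolding measure_def em[OF that] using \<nu>_nonneg[OF biregular_sets[OF that]] by simp
  have "\<nu> (topspace P) = 1"
  proof (rule \<nu>_eqI[OF biregular_sets[OF biregular.top]])
    fix \<rho> assume \<rho>: "\<rho> \<in> couplings n X \<mu>"
    show "measure \<rho> (topspace P) = 1"
      using prob_space.prob_space[OF couplingsD(1)[OF \<rho>]] unfolding couplingsD(3)[OF \<rho>] .
  qed
  then have prob_\<pi>: "prob_space \<pi>"
    using em[OF biregular.top] by (intro prob_spaceI) (simp add: sp)
  \<comment> \<open>Open sets form an intersection-stable generator, so it suffices to compare on
    them. The preimage of an open set is a biregular cylinder, on which all couplings, and therefore
    \<open>\<nu>\<close> and \<open>\<pi>\<close>, take the value given by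
    \<open>\<mu> i\<close>.\<close>
  have "distr \<pi> (borel_of (X i)) (\<lambda>x. x i) = \<mu> i" if i: "i \<in> {1..n}" for i
  proof (rule measure_eqI_generator_eq)
    interpret \<mu>: prob_space "\<mu> i"
      using prob[OF i] by (rule borel_prob_onD)
    interpret \<pi>: prob_space \<pi> by (rule prob_\<pi>)
    show "Int_stable {U. openin (X i) U}"
      by (auto simp: Int_stable_def)
    show "{U. openin (X i) U} \<subseteq> Pow (topspace (X i))"
      by (auto dest: openin_subset)
    show "sets (distr \<pi> (borel_of (X i)) (\<lambda>x. x i)) = sigma_sets (topspace (X i)) {U. openin (X i) U}"
      by (simp add: sets_borel_of)
    show "sets (\<mu> i) = sigma_sets (topspace (X i)) {U. openin (X i) U}"
      using borel_prob_onD(2)[OF prob[OF i]] by (simp add: sets_borel_of)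
    show "range (\<lambda>_. topspace (X i)) \<subseteq> {U. openin (X i) U}"
      by auto
    show "(\<Union>k::nat. topspace (X i)) = topspace (X i)"
      by auto
    have meas: "(\<lambda>x. x i) \<in> \<pi> \<rightarrow>\<^sub>M borel_of (X i)"
      using i se by (rule measurable_component)
    interpret \<delta>: prob_space "distr \<pi> (borel_of (X i)) (\<lambda>x. x i)"
      using meas by (rule \<pi>.prob_space_distr)
    show "emeasure (distr \<pi> (borel_of (X i)) (\<lambda>x. x i)) (topspace (X i)) \<noteq> \<infinity>" for k :: nat
      by simp
    fix U assume "U \<in> {U. openin (X i) U}"
    then have U: "openin (X i) U"
      by simp
    have "emeasure (distr \<pi> (borel_of (X i)) (\<lambda>x. x i)) U = emeasure \<pi> ((\<lambda>x. x i) -` U \<inter> space \<pi>)"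
      using meas borel_of_open[OF U] by (rule emeasure_distr)
    also have "(\<lambda>x. x i) -` U \<inter> space \<pi> = cyl i U"
      using sp by auto
    also have "emeasure \<pi> (cyl i U) = ennreal (\<nu> (cyl i U))"
      using cyl_biregular[OF i] U by (intro em) blast
    also have "\<nu> (cyl i U) = measure (\<mu> i) U"
      using \<nu>_eqI[OF cyl_sets[OF i borel_of_open[OF U]]] measure_cyl[OF _ i borel_of_open[OF U]]
      by blast
    finally show "emeasure (distr \<pi> (borel_of (X i)) (\<lambda>x. x i)) U = emeasure (\<mu> i) U"
      by (simp add: \<mu>.emeasure_eq_measure)
  qed
  then have "\<pi> \<in> couplings n X \<mu>"
    using prob_\<pi> se by (simp add: couplings_def borel_prob_on_def)
  then show ?thesis
    using me that by blast
qed

text \<open>A coupling is viewed through its set function, a point of a cube that is compact by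
  Tychonoff's theorem. A cluster point in the cube gives the limits on all sets, and
  \<open>coupling_of_limit\<close> turns it into a coupling.\<close>

lemma couplings_biregular_compact:
  assumes F: "F \<noteq> bot" "eventually (\<lambda>\<rho>. \<rho> \<in> couplings n X \<mu>) F"
  obtains \<pi> G where "\<pi> \<in> couplings n X \<mu>" "G \<noteq> bot" "G \<le> F"
    "\<And>A. A \<in> biregular \<Longrightarrow> ((\<lambda>\<rho>. measure \<rho> A) \<longlongrightarrow> measure \<pi> A) G"
proof -
  \<comment> \<open>The cube has one coordinate for every set, measurable or not;
    \<open>measure\<close> is 0 on non-measurable sets and so stays within
    \<open>{0..1}\<close>.\<close>
  have "compactin (product_topology (\<lambda>_. euclideanreal) UNIV) (PiE (UNIV :: (nat \<Rightarrow> 'a) set set) (\<lambda>_. {0..1}))"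
    by (simp add: compactin_PiE)
  then have "compact (PiE (UNIV :: (nat \<Rightarrow> 'a) set set) (\<lambda>_. {0..1 :: real}))"
    by (simp add: euclidean_product_topology)
  moreover have "filtermap measure F \<noteq> bot"
    using F(1) by (simp add: filtermap_bot_iff)
  moreover have "eventually (\<lambda>f. f \<in> PiE (UNIV :: (nat \<Rightarrow> 'a) set set) (\<lambda>_. {0..1 :: real})) (filtermap measure F)"
    unfolding eventually_filtermap using F(2)
  proof (rule eventually_mono)
    fix \<rho> assume "\<rho> \<in> couplings n X \<mu>"
    then interpret prob_space \<rho>
      by (rule couplingsD)
    show "measure \<rho> \<in> PiE UNIV (\<lambda>_. {0..1})"
      by (simp add: PiE_iff)
  qed
  ultimately obtain \<nu> where \<nu>: "inf (nhds \<nu>) (filtermap measure F) \<noteq> bot"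
    unfolding compact_filter by blast
  \<comment> \<open>Pulls the neighbourhoods of the cluster point back to couplings. Were
    \<open>G\<close> trivial, some property eventual in \<open>F\<close> would keep
    \<open>measure \<rho>\<close> out of a neighbourhood of \<open>\<nu>\<close>, contradicting that
    \<open>\<nu>\<close> is a cluster point.\<close>
  define G where "G = inf (filtercomap measure (nhds \<nu>)) F"
  have "G \<noteq> bot"
  proof
    assume "G = bot"
    then obtain Q R where "eventually Q (nhds \<nu>)" "eventually R F" "\<And>\<rho>. \<not> (Q (measure \<rho>) \<and> R \<rho>)"
      unfolding G_def trivial_limit_def eventually_inf eventually_filtercomap by metis
    then have "eventually (\<lambda>_. False) (inf (nhds \<nu>) (filtermap measure F))"
      unfolding eventually_inf eventually_filtermap
      by (intro exI[of _ Q] exI[of _ "\<lambda>f. \<not> Q f"]) (auto elim: eventually_mono)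
    then show False
      using \<nu> by (simp add: trivial_limit_def)
  qed
  have "G \<le> F"
    by (simp add: G_def)
  have "filterlim measure (nhds \<nu>) G"
    unfolding filterlim_iff_le_filtercomap G_def by simp
  then have lim: "((\<lambda>\<rho>. measure \<rho> A) \<longlongrightarrow> \<nu> A) G" for A
    using continuous_on_tendsto_compose[OF continuous_on_product_coordinates[of A]] by simp
  obtain \<pi> where "\<pi> \<in> couplings n X \<mu>" "\<And>A. A \<in> biregular \<Longrightarrow> measure \<pi> A = \<nu> A"
    using coupling_of_limit[OF \<open>G \<noteq> bot\<close> _ lim] filter_leD[OF \<open>G \<le> F\<close> F(2)] by blast
  then show ?thesis
    using that[OF _ \<open>G \<noteq> bot\<close> \<open>G \<le> F\<close>] lim by metis
qed

end

section \<open>Convergence of integrals\<close>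

text \<open>Dominated convergence with majorant \<open>\<bar>f x\<bar>\<close>. Applied to each
  marginal, it provides a truncation level whose excess is small in integral under all couplings
  simultaneously.\<close>

lemma truncation_tendsto_0:
  fixes f :: "'b \<Rightarrow> real"
  assumes f: "integrable M f"
  shows "(\<lambda>k. \<integral>x. max 0 (\<bar>f x\<bar> - real k) \<partial>M) \<longlonglongrightarrow> 0"
proof -
  have [measurable]: "f \<in> borel_measurable M"
    using f by (rule borel_measurable_integrable)
  have "(\<lambda>k. \<integral>x. max 0 (\<bar>f x\<bar> - real k) \<partial>M) \<longlonglongrightarrow> (\<integral>x. 0 \<partial>M)"
  proof (rule integral_dominated_convergence[where w = "\<lambda>x. \<bar>f x\<bar>"])
    show "AE x in M. (\<lambda>k. max 0 (\<bar>f x\<bar> - real k)) \<longlonglongrightarrow> 0"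
    proof (rule AE_I2)
      fix x
      obtain k0 where k0: "\<bar>f x\<bar> \<le> real k0"
        using real_arch_simple by blast
      have "eventually (\<lambda>k. max 0 (\<bar>f x\<bar> - real k) = 0) sequentially"
        by (rule eventually_sequentiallyI[of k0]) (use k0 in \<open>simp add: max_def\<close>)
      then show "(\<lambda>k. max 0 (\<bar>f x\<bar> - real k)) \<longlonglongrightarrow> 0"
        by (rule tendsto_eventually)
    qed
    show "integrable M (\<lambda>x. \<bar>f x\<bar>)"
      using f by (rule integrable_abs)
  qed auto
  then show ?thesis
    by simp
qed

lemma integrable_truncation:
  fixes f :: "'b \<Rightarrow> real"
  assumes f: "integrable M f"
  shows "integrable M (\<lambda>x. max 0 (\<bar>f x\<bar> - real k))"
proof (rule Bochner_Integration.integrable_bound[OF integrable_abs[OF f]])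
  have [measurable]: "f \<in> borel_measurable M"
    using f by (rule borel_measurable_integrable)
  show "(\<lambda>x. max 0 (\<bar>f x\<bar> - real k)) \<in> borel_measurable M"
    by measurable
qed auto

context polish_marginals
begin

lemma integral_component:
  fixes \<phi> :: "'a \<Rightarrow> real"
  assumes \<rho>: "\<rho> \<in> couplings n X \<mu>" and i: "i \<in> {1..n}" and \<phi>: "integrable (\<mu> i) \<phi>"
  shows "integrable \<rho> (\<lambda>x. \<phi> (x i))" "(\<integral>x. \<phi> (x i) \<partial>\<rho>) = (\<integral>y. \<phi> y \<partial>\<mu> i)"
proof -
  have m: "(\<lambda>x. x i) \<in> \<rho> \<rightarrow>\<^sub>M borel_of (X i)"
    using i couplingsD(2)[OF \<rho>] by (rule measurable_component)
  have d: "distr \<rho> (borel_of (X i)) (\<lambda>x. x i) = \<mu> i"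
    using \<rho> i by (simp add: couplings_def)
  have *: "integrable (distr \<rho> (borel_of (X i)) (\<lambda>x. x i)) \<phi>"
    unfolding d by (rule \<phi>)
  show "integrable \<rho> (\<lambda>x. \<phi> (x i))"
    by (rule integrable_distr[OF m *])
  have "(\<integral>y. \<phi> y \<partial>distr \<rho> (borel_of (X i)) (\<lambda>x. x i)) = (\<integral>x. \<phi> (x i) \<partial>\<rho>)"
    using borel_measurable_integrable[OF *] by (intro integral_distr[OF m]) simp
  then show "(\<integral>x. \<phi> (x i) \<partial>\<rho>) = (\<integral>y. \<phi> y \<partial>\<mu> i)"
    unfolding d by simp
qed

text \<open>The bound on \<open>\<bar>h x\<bar>\<close> splits into the excesses of the
  \<open>f i\<close> over a level \<open>R\<close>, whose integrals depend on the marginals alone,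
  and a constant \<open>real n * real R\<close>, which only matters on the complement of the box and
  is beaten by the small mass there.\<close>

lemma CL_uniform_tail:
  assumes h: "h \<in> CL n X \<mu>" and e: "e > 0"
  obtains K where "\<And>j. j \<in> {1..n} \<Longrightarrow> compactin (X j) (K j)"
    "\<And>\<rho>. \<rho> \<in> couplings n X \<mu> \<Longrightarrow>
      (\<integral>x. indicator (topspace P - PiE {1..n} K) x * \<bar>h x\<bar> \<partial>\<rho>) \<le> e"
proof -
  obtain f where f: "\<And>i. i \<in> {1..n} \<Longrightarrow> f i \<in> CL1 (X i) (\<mu> i)"
    and bd: "\<And>x. x \<in> topspace P \<Longrightarrow> \<bar>h x\<bar> \<le> (\<Sum>i=1..n. f i (x i))"
    using h unfolding CL_def by blast
  have fi: "integrable (\<mu> i) (f i)" if "i \<in> {1..n}" for i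
    using f[OF that] by (simp add: CL1_def)
  define \<phi> where "\<phi> = (\<lambda>R i y. max 0 (\<bar>f i y\<bar> - real R))"
  \<comment> \<open>The \<open>n\<close> excesses then sum to at most \<open>e / 2\<close>; the
    other half is left for the constant part.\<close>
  have "\<forall>i\<in>{1..n}. eventually (\<lambda>R. (\<integral>y. \<phi> R i y \<partial>\<mu> i) < e / (2 * real (Suc n))) sequentially"
    unfolding \<phi>_def using e by (intro ballI order_tendstoD(2)[OF truncation_tendsto_0[OF fi]]) auto
  then have "eventually (\<lambda>R. \<forall>i\<in>{1..n}. (\<integral>y. \<phi> R i y \<partial>\<mu> i) < e / (2 * real (Suc n))) sequentially"
    by (rule eventually_ball_finite[OF finite_atLeastAtMost])
  then obtain R where R: "\<And>i. i \<in> {1..n} \<Longrightarrow> (\<integral>y. \<phi> R i y \<partial>\<mu> i) < e / (2 * real (Suc n))"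
    by (metis (mono_tags, lifting) eventually_happens' sequentially_bot)
  \<comment> \<open>Chosen so that \<open>real n * real R * \<delta>\<close> is at most
    \<open>e / 2\<close>; the added 1 keeps the denominator positive when the product is 0.\<close>
  define \<delta> where "\<delta> = e / (2 * (real n * real R + 1))"
  have nR: "real n * real R + 1 > 0"
    using mult_nonneg_nonneg[of "real n" "real R"] by linarith
  then have "\<delta> > 0"
    using e by (simp add: \<delta>_def)
  then obtain K where K: "\<And>j. j \<in> {1..n} \<Longrightarrow> compactin (X j) (K j)"
      "\<And>\<rho>. \<rho> \<in> couplings n X \<mu> \<Longrightarrow>
        measure \<rho> (PiE {1..n} (\<lambda>j. topspace (X j)) - PiE {1..n} K) \<le> \<delta>"
    using exhausting_box[of "\<lambda>j. topspace (X j)" \<delta>] openin_topspace by metis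
  define S where "S = topspace P - PiE {1..n} K"
  have "compactin P (PiE {1..n} K)"
    using K(1) by (simp add: compactin_PiE)
  then have S_sets: "S \<in> sets (borel_of P)"
    unfolding S_def using sets.compl_sets[OF compactin_P_sets] by simp
  show ?thesis
  proof (rule that[OF K(1)])
    fix \<rho> assume \<rho>: "\<rho> \<in> couplings n X \<mu>"
    interpret \<rho>: prob_space \<rho>
      using \<rho> by (rule couplingsD)
    have S: "S \<in> sets \<rho>"
      using S_sets couplingsD(2)[OF \<rho>] by simp
    have \<phi>i: "integrable \<rho> (\<lambda>x. \<phi> R i (x i))" "(\<integral>x. \<phi> R i (x i) \<partial>\<rho>) = (\<integral>y. \<phi> R i y \<partial>\<mu> i)"
      if "i \<in> {1..n}" for i
      using integral_component[OF \<rho> that integrable_truncation[OF fi[OF that]]]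
      unfolding \<phi>_def by auto
    have i1: "integrable \<rho> (\<lambda>x. \<Sum>i=1..n. \<phi> R i (x i))"
      by (rule Bochner_Integration.integrable_sum) (rule \<phi>i)
    have i2: "integrable \<rho> (\<lambda>x. real n * real R * indicator S x)"
      using S by (simp add: \<rho>.emeasure_eq_measure)
    have ih: "integrable \<rho> (\<lambda>x. indicator S x * \<bar>h x\<bar>)"
      using integrable_real_mult_indicator[OF S integrable_abs[OF CL_integrable[OF h \<rho>]]]
      by (simp add: mult.commute)
    have "(\<integral>x. indicator S x * \<bar>h x\<bar> \<partial>\<rho>)
        \<le> (\<integral>x. (\<Sum>i=1..n. \<phi> R i (x i)) + real n * real R * indicator S x \<partial>\<rho>)"
    proof (rule integral_mono[OF ih Bochner_Integration.integrable_add[OF i1 i2]])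
      fix x assume "x \<in> space \<rho>"
      then have "\<bar>h x\<bar> \<le> (\<Sum>i=1..n. f i (x i))"
        using bd couplingsD(3)[OF \<rho>] by simp
      also have "\<dots> \<le> (\<Sum>i=1..n. \<phi> R i (x i) + real R)"
        by (rule sum_mono) (simp add: \<phi>_def)
      also have "\<dots> = (\<Sum>i=1..n. \<phi> R i (x i)) + real n * real R"
        by (simp add: sum.distrib)
      finally have "\<bar>h x\<bar> \<le> (\<Sum>i=1..n. \<phi> R i (x i)) + real n * real R" .
      \<comment> \<open>Handles the points outside \<open>S\<close>, where the left-hand side
        vanishes.\<close>
      moreover have "0 \<le> (\<Sum>i=1..n. \<phi> R i (x i))"
        by (rule sum_nonneg) (simp add: \<phi>_def)
      ultimately show "indicator S x * \<bar>h x\<bar>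
          \<le> (\<Sum>i=1..n. \<phi> R i (x i)) + real n * real R * indicator S x"
        by (simp add: indicator_def)
    qed
    also have "\<dots> = (\<integral>x. (\<Sum>i=1..n. \<phi> R i (x i)) \<partial>\<rho>) + (\<integral>x. real n * real R * indicator S x \<partial>\<rho>)"
      by (rule Bochner_Integration.integral_add[OF i1 i2])
    also have "(\<integral>x. (\<Sum>i=1..n. \<phi> R i (x i)) \<partial>\<rho>) = (\<Sum>i=1..n. \<integral>y. \<phi> R i y \<partial>\<mu> i)"
      using \<phi>i by (simp add: Bochner_Integration.integral_sum)
    also have "\<dots> \<le> (\<Sum>i=1..n. e / (2 * real (Suc n)))"
      by (rule sum_mono) (rule less_imp_le[OF R])
    also have "\<dots> \<le> e / 2"
      using e by (simp add: field_simps)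
    also have "(\<integral>x. real n * real R * indicator S x \<partial>\<rho>) = real n * real R * measure \<rho> S"
      using S by simp
    also have "\<dots> \<le> real n * real R * \<delta>"
      using K(2)[OF \<rho>] by (intro mult_left_mono) (simp_all add: S_def)
    also have "\<dots> \<le> e / 2"
      using e nR by (simp add: \<delta>_def field_simps)
    finally show "(\<integral>x. indicator (topspace P - PiE {1..n} K) x * \<bar>h x\<bar> \<partial>\<rho>) \<le> e"
      unfolding S_def by simp
  qed
qed

text \<open>Outside a compact box \<open>C\<close> the integral of \<open>h\<close> is uniformly
  small. Inside, compactness gives finitely many open boxes on each of which \<open>h\<close> stays
  within \<open>e / 2\<close> of its value at a chosen point; made disjoint, their traces on
  \<open>C\<close> carry a step function. The sets and coefficients do not depend on the
  coupling.\<close>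

lemma CL_simple_approximation:
  assumes h: "h \<in> CL n X \<mu>" and e: "e > 0"
  obtains m :: nat and A a where "\<And>k. A k \<in> biregular"
    "\<And>\<rho>. \<rho> \<in> couplings n X \<mu> \<Longrightarrow> \<bar>(\<integral>x. h x \<partial>\<rho>) - (\<Sum>k<m. a k * measure \<rho> (A k))\<bar> \<le> e"
proof -
  obtain K where K: "\<And>j. j \<in> {1..n} \<Longrightarrow> compactin (X j) (K j)"
      "\<And>\<rho>. \<rho> \<in> couplings n X \<mu> \<Longrightarrow>
        (\<integral>x. indicator (topspace P - PiE {1..n} K) x * \<bar>h x\<bar> \<partial>\<rho>) \<le> e / 2"
    using CL_uniform_tail[OF h, of "e / 2"] e by auto
  define C where "C = PiE {1..n} K"
  have C: "compactin P C"
    using K(1) by (simp add: compactin_PiE C_def)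
  have CP: "C \<subseteq> topspace P"
    using compactin_subset_topspace[OF C] .
  have C_bi: "C \<in> biregular"
    unfolding C_def using K(1) by (intro box_biregular disjI2 compactin_imp_closedin Hausdorff_X)
  have hc: "continuous_map P euclideanreal h"
    using h by (simp add: CL_def)
  have "\<exists>V. (\<forall>j\<in>{1..n}. openin (X j) (V j)) \<and> x \<in> PiE {1..n} V \<and>
      (\<forall>y\<in>PiE {1..n} V. \<bar>h y - h x\<bar> < e / 2)" if x: "x \<in> C" for x
  proof -
    have "openin P {y \<in> topspace P. h y \<in> ball (h x) (e / 2)}"
      using hc by (rule openin_continuous_map_preimage) simp
    moreover have "x \<in> {y \<in> topspace P. h y \<in> ball (h x) (e / 2)}"
      using x CP e by auto
    ultimately have "\<exists>V. finite {j \<in> {1..n}. V j \<noteq> topspace (X j)} \<and>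
        (\<forall>j\<in>{1..n}. openin (X j) (V j)) \<and> x \<in> PiE {1..n} V \<and>
        PiE {1..n} V \<subseteq> {y \<in> topspace P. h y \<in> ball (h x) (e / 2)}"
      unfolding openin_product_topology_alt by (rule bspec)
    then obtain V where V: "\<forall>j\<in>{1..n}. openin (X j) (V j)" "x \<in> PiE {1..n} V"
        "PiE {1..n} V \<subseteq> {y \<in> topspace P. h y \<in> ball (h x) (e / 2)}"
      by blast
    then have "\<bar>h y - h x\<bar> < e / 2" if "y \<in> PiE {1..n} V" for y
      using that by (auto simp: dist_real_def abs_minus_commute)
    then show ?thesis
      using V by blast
  qed
  then obtain V where "\<forall>x\<in>C. (\<forall>j\<in>{1..n}. openin (X j) (V x j)) \<and> x \<in> PiE {1..n} (V x) \<and>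
      (\<forall>y\<in>PiE {1..n} (V x). \<bar>h y - h x\<bar> < e / 2)"
    by (rule bchoice[OF ballI, THEN exE])
  then have V: "\<And>x j. x \<in> C \<Longrightarrow> j \<in> {1..n} \<Longrightarrow> openin (X j) (V x j)"
      "\<And>x. x \<in> C \<Longrightarrow> x \<in> PiE {1..n} (V x)"
      "\<And>x y. x \<in> C \<Longrightarrow> y \<in> PiE {1..n} (V x) \<Longrightarrow> \<bar>h y - h x\<bar> < e / 2"
    by blast+
  define \<U> where "\<U> = (\<lambda>x. PiE {1..n} (V x)) ` C"
  have "openin P U" if "U \<in> \<U>" for U
    using that V(1) unfolding \<U>_def by (auto simp: openin_PiE_gen)
  moreover have "C \<subseteq> \<Union>\<U>"
    using V(2) by (auto simp: \<U>_def)
  ultimately have "\<exists>\<F>. finite \<F> \<and> \<F> \<subseteq> \<U> \<and> C \<subseteq> \<Union>\<F>"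
    by (rule compactinD[OF C])
  then obtain \<F> where \<F>: "finite \<F>" "\<F> \<subseteq> \<U>" "C \<subseteq> \<Union>\<F>"
    by blast
  obtain F where F: "finite F" "F \<subseteq> C" "\<F> = (\<lambda>x. PiE {1..n} (V x)) ` F"
    using finite_subset_image[OF \<F>(1) \<F>(2)[unfolded \<U>_def]] by blast
  obtain m :: nat and p where p: "F = p ` {..<m}"
    using finite_imp_nat_seg_image_inj_on[OF F(1)] by (auto simp: lessThan_def)
  \<comment> \<open>\<open>disjointed\<close> works on infinite sequences, so the finite cover is
    padded with empty sets. Since \<open>biregular\<close> is an algebra, the disjoint pieces remain
    in it.\<close>
  define E where "E = (\<lambda>k. if k < m then C \<inter> PiE {1..n} (V (p k)) else {})"
  have pC: "p k \<in> C" if "k < m" for k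
    using that p F(2) by auto
  have E_bi: "range E \<subseteq> biregular"
    unfolding E_def using pC V(1) by (auto intro!: biregular.Int C_bi box_biregular)
  define A where "A = disjointed E"
  have A_bi: "A k \<in> biregular" for k
    using biregular.range_disjointed_sets[OF E_bi] by (auto simp: A_def)
  have AE': "A k \<subseteq> E k" for k
    unfolding A_def by (rule disjointed_subset)
  have dj: "disjoint_family A"
    unfolding A_def by (rule disjoint_family_disjointed)
  have UA: "(\<Union>k. A k) = C"
    unfolding A_def UN_disjointed_eq using \<F>(3) F(3) p by (auto simp: E_def split: if_splits)
  \<comment> \<open>The step function takes the value of \<open>h\<close> at the chosen point
    \<open>p k\<close> on the piece \<open>A k\<close>; it vanishes off \<open>C\<close>, where the
    error is \<open>\<bar>h y\<bar>\<close> itself.\<close>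
  define s where "s = (\<lambda>y. \<Sum>k<m. h (p k) * indicator (A k) y :: real)"
  have s_in: "\<bar>h y - s y\<bar> \<le> e / 2" if y: "y \<in> C" for y
  proof -
    obtain k where k: "y \<in> A k"
      using UA y by auto
    then have "y \<in> E k"
      using AE' by auto
    then have km: "k < m" and "y \<in> PiE {1..n} (V (p k))"
      by (auto simp: E_def split: if_splits)
    have "y \<notin> A l" if "l \<noteq> k" for l
      using dj k that by (auto simp: disjoint_family_on_def)
    then have "s y = (\<Sum>l<m. if l = k then h (p k) else 0)"
      unfolding s_def using k by (intro sum.cong) (auto simp: indicator_def)
    also have "\<dots> = h (p k)"
      using km by simp
    finally show ?thesis
      using V(3)[OF pC[OF km] \<open>y \<in> PiE {1..n} (V (p k))\<close>] by simp
  qed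
  have s_out: "s y = 0" if y: "y \<notin> C" for y
    unfolding s_def using UA y by (intro sum.neutral) (auto simp: indicator_def)
  show ?thesis
  proof (rule that[OF A_bi])
    fix \<rho> assume \<rho>: "\<rho> \<in> couplings n X \<mu>"
    interpret \<rho>: prob_space \<rho>
      using \<rho> by (rule couplingsD)
    have hi: "integrable \<rho> h"
      using h \<rho> by (rule CL_integrable)
    have Am: "A k \<in> sets \<rho>" for k
      using biregular_sets[OF A_bi] couplingsD(2)[OF \<rho>] by simp
    have si0: "integrable \<rho> (\<lambda>y. h (p k) * indicator (A k) y)" for k
      using Am by (simp add: \<rho>.emeasure_eq_measure)
    have si: "integrable \<rho> s"
      unfolding s_def by (rule Bochner_Integration.integrable_sum) (rule si0)
    have s_int: "(\<integral>y. s y \<partial>\<rho>) = (\<Sum>k<m. h (p k) * measure \<rho> (A k))"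
      unfolding s_def Bochner_Integration.integral_sum[OF si0] using Am by simp
    have "topspace P - C \<in> sets \<rho>"
      using biregular_sets[OF biregular.compl_sets[OF C_bi]] couplingsD(2)[OF \<rho>] by simp
    then have ti: "integrable \<rho> (\<lambda>y. indicator (topspace P - C) y * \<bar>h y\<bar>)"
      using integrable_real_mult_indicator[OF _ integrable_abs[OF hi]]
      by (simp add: mult.commute)
    have "\<bar>(\<integral>x. h x \<partial>\<rho>) - (\<integral>y. s y \<partial>\<rho>)\<bar> = \<bar>\<integral>y. h y - s y \<partial>\<rho>\<bar>"
      using hi si by simp
    also have "\<dots> \<le> (\<integral>y. \<bar>h y - s y\<bar> \<partial>\<rho>)"
      by (rule integral_abs_bound)
    also have "\<dots> \<le> (\<integral>y. e / 2 + indicator (topspace P - C) y * \<bar>h y\<bar> \<partial>\<rho>)"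
    proof (rule integral_mono)
      show "integrable \<rho> (\<lambda>y. \<bar>h y - s y\<bar>)"
        using hi si by simp
      show "integrable \<rho> (\<lambda>y. e / 2 + indicator (topspace P - C) y * \<bar>h y\<bar>)"
        using ti by simp
      fix y assume "y \<in> space \<rho>"
      then have "y \<in> topspace P"
        using couplingsD(3)[OF \<rho>] by simp
      then show "\<bar>h y - s y\<bar> \<le> e / 2 + indicator (topspace P - C) y * \<bar>h y\<bar>"
        using s_in[of y] s_out[of y] e by (cases "y \<in> C") auto
    qed
    also have "\<dots> = e / 2 + (\<integral>y. indicator (topspace P - C) y * \<bar>h y\<bar> \<partial>\<rho>)"
      using ti by (simp add: \<rho>.prob_space)
    also have "\<dots> \<le> e"
      using K(2)[OF \<rho>] unfolding C_def by simp
    finally show "\<bar>(\<integral>x. h x \<partial>\<rho>) - (\<Sum>k<m. h (p k) * measure \<rho> (A k))\<bar> \<le> e"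
      unfolding s_int .
  qed
qed

text \<open>Convergence on \<open>biregular\<close> gives convergence of integrals of step
  functions; approximating \<open>h\<close> under \<open>\<rho>\<close> and under
  \<open>\<pi>\<close> accounts for the other two thirds of \<open>e\<close>. The filter
  \<open>G\<close> is fixed before \<open>h\<close>, so a single limit serves the cost and all
  constraints.\<close>

lemma couplings_compact:
  assumes F: "F \<noteq> bot" "eventually (\<lambda>\<rho>. \<rho> \<in> couplings n X \<mu>) F"
  obtains \<pi> G where "\<pi> \<in> couplings n X \<mu>" "G \<noteq> bot" "G \<le> F"
    "\<And>h. h \<in> CL n X \<mu> \<Longrightarrow> ((\<lambda>\<rho>. \<integral>x. h x \<partial>\<rho>) \<longlongrightarrow> (\<integral>x. h x \<partial>\<pi>)) G"
proof -
  obtain \<pi> G where \<pi>: "\<pi> \<in> couplings n X \<mu>" and G: "G \<noteq> bot" "G \<le> F"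
    and lim: "\<And>A. A \<in> biregular \<Longrightarrow> ((\<lambda>\<rho>. measure \<rho> A) \<longlongrightarrow> measure \<pi> A) G"
    using couplings_biregular_compact[OF F] by metis
  have GC: "eventually (\<lambda>\<rho>. \<rho> \<in> couplings n X \<mu>) G"
    using filter_leD[OF G(2) F(2)] .
  have "((\<lambda>\<rho>. \<integral>x. h x \<partial>\<rho>) \<longlongrightarrow> (\<integral>x. h x \<partial>\<pi>)) G" if h: "h \<in> CL n X \<mu>" for h
  proof (rule tendstoI)
    fix e :: real assume e: "e > 0"
    obtain m :: nat and A a where A: "\<And>k. A k \<in> biregular"
      and a: "\<And>\<rho>. \<rho> \<in> couplings n X \<mu> \<Longrightarrow>
        \<bar>(\<integral>x. h x \<partial>\<rho>) - (\<Sum>k<m. a k * measure \<rho> (A k))\<bar> \<le> e / 3"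
      using CL_simple_approximation[OF h, of "e / 3"] e by (metis zero_less_divide_iff zero_less_numeral)
    have "((\<lambda>\<rho>. \<Sum>k<m. a k * measure \<rho> (A k)) \<longlongrightarrow> (\<Sum>k<m. a k * measure \<pi> (A k))) G"
      by (intro tendsto_sum tendsto_mult tendsto_const lim A)
    then have "eventually (\<lambda>\<rho>. dist (\<Sum>k<m. a k * measure \<rho> (A k)) (\<Sum>k<m. a k * measure \<pi> (A k)) < e / 3) G"
      by (rule tendstoD) (use e in simp)
    with GC show "eventually (\<lambda>\<rho>. dist (\<integral>x. h x \<partial>\<rho>) (\<integral>x. h x \<partial>\<pi>) < e) G"
    proof eventually_elim
      case (elim \<rho>)
      then show ?case
        using a[OF elim(1)] a[OF \<pi>] unfolding dist_real_def by linarith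
    qed
  qed
  then show ?thesis
    using that[OF \<pi> G] by blast
qed

end

section \<open>Existence of a minimizer\<close>

theorem proposition1p6:
  fixes n :: nat
    and X :: "nat \<Rightarrow> 'a topology"
    and \<mu> :: "nat \<Rightarrow> 'a measure"
    and W :: "((nat \<Rightarrow> 'a) \<Rightarrow> real) set"
    and c :: "(nat \<Rightarrow> 'a) \<Rightarrow> real"
  assumes "n \<ge> 1"
    and "\<And>i. i \<in> {1..n} \<Longrightarrow> polish_topology (X i)"
    and "\<And>i. i \<in> {1..n} \<Longrightarrow> borel_prob_on (X i) (\<mu> i)"
    and "W \<subseteq> CL n X \<mu>"
    and "linear_subspace_fun W"
    and "c \<in> CL n X \<mu>"
  shows "(\<exists>\<pi>\<in>couplings_W n X \<mu> W.
            ereal (\<integral>x. c x \<partial>\<pi>) = (INF \<rho>\<in>couplings_W n X \<mu> W. ereal (\<integral>x. c x \<partial>\<rho>)))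
         \<longleftrightarrow> couplings_W n X \<mu> W \<noteq> {}"
proof
  assume ne: "couplings_W n X \<mu> W \<noteq> {}"
  interpret polish_marginals n X \<mu>
    using assms(2,3) by unfold_locales
  \<comment> \<open>Sublevel sets of the cost, one for each competitor. Of any two, one contains the
    other, so they form a filter base, and each contains its own \<open>\<sigma>\<close>, so the
    filter \<open>F\<close> they generate is proper. It plays the part of a minimizing
    sequence.\<close>
  let ?Q = "\<lambda>\<sigma>. {\<rho> \<in> couplings_W n X \<mu> W. (\<integral>x. c x \<partial>\<rho>) \<le> (\<integral>x. c x \<partial>\<sigma>)}"
  define F where "F = (INF \<sigma>\<in>couplings_W n X \<mu> W. principal (?Q \<sigma>))"
  have ev: "eventually R F \<longleftrightarrow> (\<exists>\<sigma>\<in>couplings_W n X \<mu> W. \<forall>\<rho>\<in>?Q \<sigma>. R \<rho>)" for R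
  proof -
    have "\<exists>\<sigma>\<in>couplings_W n X \<mu> W. principal (?Q \<sigma>) \<le> inf (principal (?Q \<sigma>1)) (principal (?Q \<sigma>2))"
      if "\<sigma>1 \<in> couplings_W n X \<mu> W" "\<sigma>2 \<in> couplings_W n X \<mu> W" for \<sigma>1 \<sigma>2
      by (rule bexI[of _ "if (\<integral>x. c x \<partial>\<sigma>1) \<le> (\<integral>x. c x \<partial>\<sigma>2) then \<sigma>1 else \<sigma>2"])
        (use that in auto)
    then show ?thesis
      unfolding F_def by (subst eventually_INF_base[OF ne]) (simp_all only: eventually_principal)
  qed
  have "F \<noteq> bot"
    unfolding trivial_limit_def ev by auto
  moreover have F_W: "eventually (\<lambda>\<rho>. \<rho> \<in> couplings_W n X \<mu> W) F"
    unfolding ev using ne by auto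
  then have "eventually (\<lambda>\<rho>. \<rho> \<in> couplings n X \<mu>) F"
    by (rule eventually_mono) (simp add: couplings_W_def)
  ultimately obtain \<pi> G where \<pi>: "\<pi> \<in> couplings n X \<mu>" and G: "G \<noteq> bot" "G \<le> F"
    and lim: "\<And>h. h \<in> CL n X \<mu> \<Longrightarrow> ((\<lambda>\<rho>. \<integral>x. h x \<partial>\<rho>) \<longlongrightarrow> (\<integral>x. h x \<partial>\<pi>)) G"
    using couplings_compact by metis
  \<comment> \<open>Members of \<open>W\<close> lie in \<open>CL n X \<mu>\<close>, so their
    integrals, which are eventually 0 along \<open>G\<close>, converge to the integral under
    \<open>\<pi>\<close>.\<close>
  have "(\<integral>x. w x \<partial>\<pi>) = 0" if w: "w \<in> W" for w
  proof -
    have "eventually (\<lambda>\<rho>. (\<integral>x. w x \<partial>\<rho>) = 0) G"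
      using filter_leD[OF G(2) F_W] by (rule eventually_mono) (use w in \<open>simp add: couplings_W_def\<close>)
    then have "((\<lambda>\<rho>. \<integral>x. w x \<partial>\<rho>) \<longlongrightarrow> 0) G"
      by (rule tendsto_eventually)
    then show ?thesis
      using tendsto_unique[OF G(1)] lim w assms(4) by blast
  qed
  then have \<pi>W: "\<pi> \<in> couplings_W n X \<mu> W"
    using \<pi> by (simp add: couplings_W_def)
  \<comment> \<open>Each competitor's sublevel set belongs to \<open>F\<close> and hence to the
    finer \<open>G\<close>, so its cost bounds the limit of the costs, which is the cost of
    \<open>\<pi>\<close>.\<close>
  have "(\<integral>x. c x \<partial>\<pi>) \<le> (\<integral>x. c x \<partial>\<sigma>)" if "\<sigma> \<in> couplings_W n X \<mu> W" for \<sigma>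
  proof (rule tendsto_upperbound[OF lim[OF assms(6)] _ G(1)])
    have "eventually (\<lambda>\<rho>. (\<integral>x. c x \<partial>\<rho>) \<le> (\<integral>x. c x \<partial>\<sigma>)) F"
      unfolding ev using that by blast
    then show "eventually (\<lambda>\<rho>. (\<integral>x. c x \<partial>\<rho>) \<le> (\<integral>x. c x \<partial>\<sigma>)) G"
      by (rule filter_leD[OF G(2)])
  qed
  then have "ereal (\<integral>x. c x \<partial>\<pi>) = (INF \<rho>\<in>couplings_W n X \<mu> W. ereal (\<integral>x. c x \<partial>\<rho>))"
    using \<pi>W by (intro antisym INF_greatest INF_lower) auto
  then show "\<exists>\<pi>\<in>couplings_W n X \<mu> W.
      ereal (\<integral>x. c x \<partial>\<pi>) = (INF \<rho>\<in>couplings_W n X \<mu> W. ereal (\<integral>x. c x \<partial>\<rho>))"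
    using \<pi>W by blast
\<comment> \<open>The remaining implication: a minimizer is itself an element of the constraint
  set.\<close>
qed auto

end
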